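(* Let $F$ be a field, let $n\ge 2$ and $1\le k\le n-1$ be integers, let $A=(a_{ij})$ be an invertible $n\times n$ matrix over $F$, and let $b=[b_1,\ldots,b_n]^T\in F^n$. Suppose that the leading submatrix $A_0=(a_{ij})_{1\le i,j\le k}$ is invertible. For $p,q\in\{k+1,\ldots,n\}$ set $$\hat c_{pq}=\det\begin{bmatrix} & & & a_{1q}\\ & A_0 & & \vdots\\ & & & a_{kq}\\ a_{p1} & \cdots & a_{pk} & a_{pq}\end{bmatrix},$$ and let $\hat C=(\hat c_{pq})_{k+1\le p,q\le n}$. For $j\in\{k+1,\ldots,n\}$ set $$b_j'=\det\begin{bmatrix} & & & b_1\\ & A_0 & & \vdots\\ & & & b_k\\ a_{j1} & \cdots & a_{jk} & b_j\end{bmatrix},$$ and let $b^{(k)}=[b'_{k+1},b'_{k+2},\ldots,b'_n]^T$. Then the linear system $Ax=b$ has the same corresponding solution as the linear system $\hat C x^{(k)}=b^{(k)}$ in the unknowns $x^{(k)}=[x_{k+1},x_{k+2},\ldots,x_n]^T$; that is, if $x=[x_1,\ldots,x_n]^T$ is the unique solution of $Ax=b$, then $[x_{k+1},\ldots,x_n]^T$ is the unique solution of $\hat C x^{(k)}=b^{(k)}$.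
   Context: The matrices displayed are $(k+1)\times(k+1)$ bordered matrices: the upper-left $k\times k$ block is $A_0$, bordered by one additional column and one additional row. The rows and columns of $\hat C$ are indexed by $k+1,\ldots,n$. *)

theory Defs
  imports "Jordan_Normal_Form.Determinant"
begin

(* Matrices and vectors are indexed from 0, so the mathematical index i in {1..n} appears below
   as i - 1 in {0..<n}, and the range {k+1..n} becomes {k..<n}. *)

definition leading_block :: "nat \<Rightarrow> 'a mat \<Rightarrow> 'a mat" where
  "leading_block k A = mat k k (\<lambda>(i, j). A $$ (i, j))"

text \<open>The matrix with blocks \<open>M\<close>, \<open>u\<close> (as a column), \<open>v\<close> (as a row) and \<open>d\<close>:
  \<open>M\<close> bordered by one column on the right and one row at the bottom.\<close>

definition bordered_mat :: "'a mat \<Rightarrow> 'a vec \<Rightarrow> 'a vec \<Rightarrow> 'a \<Rightarrow> 'a mat" where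
  "bordered_mat M u v d =
     four_block_mat M (mat_of_cols (dim_vec u) [u]) (mat_of_rows (dim_vec v) [v]) (mat 1 1 (\<lambda>_. d))"

definition c_hat :: "nat \<Rightarrow> 'a :: field mat \<Rightarrow> nat \<Rightarrow> nat \<Rightarrow> 'a" where
  "c_hat k A p q =
     det (bordered_mat (leading_block k A)
       (vec k (\<lambda>i. A $$ (i, q))) (vec k (\<lambda>j. A $$ (p, j))) (A $$ (p, q)))"

definition b_prime :: "nat \<Rightarrow> 'a :: field mat \<Rightarrow> 'a vec \<Rightarrow> nat \<Rightarrow> 'a" where
  "b_prime k A b j =
     det (bordered_mat (leading_block k A)
       (vec_first b k) (vec k (\<lambda>i. A $$ (j, i))) (b $ j))"

(* Position (p, q) of C_hat stores the entry c_hat with row index k + p and column index k + q;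
   b_reduced is shifted by k in the same way. *)

definition C_hat :: "nat \<Rightarrow> 'a :: field mat \<Rightarrow> 'a mat" where
  "C_hat k A = mat (dim_row A - k) (dim_col A - k) (\<lambda>(p, q). c_hat k A (k + p) (k + q))"

definition b_reduced :: "nat \<Rightarrow> 'a :: field mat \<Rightarrow> 'a vec \<Rightarrow> 'a vec" where
  "b_reduced k A b = vec (dim_row A - k) (\<lambda>j. b_prime k A b (k + j))"

definition is_solution :: "'a :: field mat \<Rightarrow> 'a vec \<Rightarrow> 'a vec \<Rightarrow> bool" where
  "is_solution M r x \<longleftrightarrow> x \<in> carrier_vec (dim_col M) \<and> M *\<^sub>v x = r"

definition is_unique_solution :: "'a :: field mat \<Rightarrow> 'a vec \<Rightarrow> 'a vec \<Rightarrow> bool" where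
  "is_unique_solution M r x \<longleftrightarrow> is_solution M r x \<and> (\<forall>y. is_solution M r y \<longrightarrow> y = x)"

end

theory Submission
  imports Defs
begin

text \<open>
  The reduced system is block Gaussian elimination, scaled by \<open>det A\<^sub>0\<close>.  Write \<open>A\<close> in blocks with
  upper row \<open>A\<^sub>0, B\<close> and lower row \<open>C, D\<close>, and \<open>b\<close> as \<open>b\<^sub>1\<close> above \<open>b\<^sub>2\<close>.  Since \<open>A\<^sub>0\<close> is invertible
  there is \<open>L = C A\<^sub>0\<inverse>\<close> with \<open>L A\<^sub>0 = C\<close>, and subtracting \<open>L\<close> times the upper rows from the lower ones
  turns \<open>A x = b\<close> into the equivalent pair \<open>A\<^sub>0 x\<^sub>1 + B x\<^sub>2 = b\<^sub>1\<close> and \<open>(D - L B) x\<^sub>2 = b\<^sub>2 - L b\<^sub>1\<close>.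
  The first equation determines \<open>x\<^sub>1\<close> from \<open>x\<^sub>2\<close>, so every solution of the second extends to a
  solution of \<open>A x = b\<close>, and uniqueness passes from the full system to the Schur complement
  (\<open>unique_solution_schur_complement\<close>).

  The same elimination applied to the last row of a bordered matrix shows that its determinant is
  \<open>det A\<^sub>0\<close> times a single eliminated entry (\<open>det_bordered_mat\<close>).  Hence the matrix of bordered
  determinants is \<open>det A\<^sub>0 (D - L B)\<close>, the reduced right-hand side is \<open>det A\<^sub>0 (b\<^sub>2 - L b\<^sub>1)\<close>, and the
  common nonzero factor \<open>det A\<^sub>0\<close> does not affect the solutions.
\<close>

lemma invertible_mat_obtain_inverse:
  assumes A: "A \<in> carrier_mat n n" and "invertible_mat A"
  obtains N where "N \<in> carrier_mat n n" "A * N = 1\<^sub>m n" "N * A = 1\<^sub>m n"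
proof -
  obtain N where AN: "A * N = 1\<^sub>m n" and NA: "N * A = 1\<^sub>m (dim_row N)"
    using assms unfolding invertible_mat_def inverts_mat_def by auto
  have "dim_col N = n" "dim_row N = n"
    using arg_cong[OF AN, of dim_col] arg_cong[OF NA, of dim_col] A by auto
  with that[of N] AN NA show thesis by auto
qed

lemma invertible_mat_det_nonzero:
  fixes A :: "'a :: field mat"
  assumes A: "A \<in> carrier_mat n n" and inv: "invertible_mat A"
  shows "det A \<noteq> 0"
proof -
  obtain N where N: "N \<in> carrier_mat n n" "A * N = 1\<^sub>m n"
    using invertible_mat_obtain_inverse[OF A inv] by blast
  then have "det A * det N = 1"
    using det_mult[OF A N(1)] by simp
  then show ?thesis by auto
qed

lemma invertible_mat_unique_solution:
  fixes A :: "'a :: field mat"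
  assumes A: "A \<in> carrier_mat n n" and inv: "invertible_mat A" and b: "b \<in> carrier_vec n"
  shows "\<exists>x. is_unique_solution A b x"
proof -
  obtain N where N: "N \<in> carrier_mat n n" "A * N = 1\<^sub>m n" "N * A = 1\<^sub>m n"
    using invertible_mat_obtain_inverse[OF A inv] by blast
  have "A *\<^sub>v (N *\<^sub>v b) = b"
    using assoc_mult_mat_vec[OF A N(1) b] N(2) b by simp
  moreover have "y = N *\<^sub>v b" if "y \<in> carrier_vec n" "A *\<^sub>v y = b" for y
    using assoc_mult_mat_vec[OF N(1) A that(1)] N(3) that by simp
  ultimately have "is_unique_solution A b (N *\<^sub>v b)"
    using A N(1) b unfolding is_unique_solution_def is_solution_def by auto
  then show ?thesis ..
qed

lemma is_unique_solution_smult: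
  fixes M :: "'a :: field mat"
  assumes M: "M \<in> carrier_mat m n" and r: "r \<in> carrier_vec m" and c: "c \<noteq> 0"
  shows "is_unique_solution (c \<cdot>\<^sub>m M) (c \<cdot>\<^sub>v r) x \<longleftrightarrow> is_unique_solution M r x"
proof -
  have "c \<cdot>\<^sub>m M *\<^sub>v y = c \<cdot>\<^sub>v r \<longleftrightarrow> M *\<^sub>v y = r" if "y \<in> carrier_vec n" for y
    using M r c that by (auto simp: vec_eq_iff smult_scalar_prod_distrib[of _ n])
  then have "is_solution (c \<cdot>\<^sub>m M) (c \<cdot>\<^sub>v r) y \<longleftrightarrow> is_solution M r y" for y
    using M unfolding is_solution_def by auto
  then show ?thesis unfolding is_unique_solution_def by simp
qed

text \<open>If the bordering row is the combination of the rows of \<open>M\<close> with coefficients \<open>l\<close>, then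
  subtracting that combination clears it and leaves the corner entry \<open>d - l \<bullet> u\<close>.  As a matrix
  product, the elimination is multiplication by a unipotent lower triangular matrix.\<close>

lemma det_bordered_mat:
  fixes M :: "'a :: field mat"
  assumes M: "M \<in> carrier_mat k k" and u: "u \<in> carrier_vec k" and v: "v \<in> carrier_vec k"
    and l: "l \<in> carrier_vec k" and comb: "\<And>j. j < k \<Longrightarrow> l \<bullet> col M j = v $ j"
  shows "det (bordered_mat M u v d) = det M * (d - l \<bullet> u)"
proof -
  let ?U = "mat_of_cols k [u]" and ?V = "mat_of_rows k [v]" and ?d = "mat 1 1 (\<lambda>_. d)"
  let ?l = "mat_of_rows k [- l]"
  let ?E = "four_block_mat (1\<^sub>m k) (0\<^sub>m k 1) ?l (1\<^sub>m 1)"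
  let ?s = "mat 1 1 (\<lambda>_. d - l \<bullet> u)"
  have c: "?U \<in> carrier_mat k 1" "?V \<in> carrier_mat 1 k" "?d \<in> carrier_mat 1 1"
    "?l \<in> carrier_mat 1 k" "?s \<in> carrier_mat 1 1"
    by (auto simp: mat_of_cols_def mat_of_rows_def)
  have bordered: "bordered_mat M u v d = four_block_mat M ?U ?V ?d"
    using u v unfolding bordered_mat_def by auto
  have "?l * M + 1\<^sub>m 1 * ?V = 0\<^sub>m 1 k"
    using M v l c comb
    by (intro eq_matI) (auto simp: mat_of_rows_def[of _ "[v]"] scalar_prod_uminus_left)
  moreover have "?l * ?U + 1\<^sub>m 1 * ?d = ?s"
    using u l c by (intro eq_matI) (auto simp: scalar_prod_uminus_left)
  ultimately have "?E * four_block_mat M ?U ?V ?d = four_block_mat M ?U (0\<^sub>m 1 k) ?s"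
    using M c
    by (subst mult_four_block_mat[of _ k k _ 1 _ 1 _ _ k _ 1]) auto
  then have "det ?E * det (four_block_mat M ?U ?V ?d) = det (four_block_mat M ?U (0\<^sub>m 1 k) ?s)"
    using M c by (subst det_mult[of _ "k + 1", symmetric]) auto
  also have "det ?E = 1"
    using c by (subst det_four_block_mat_upper_right_zero[of _ k _ 1]) auto
  also have "det (four_block_mat M ?U (0\<^sub>m 1 k) ?s) = det M * (d - l \<bullet> u)"
    using M c by (subst det_four_block_mat_lower_left_zero[of _ k _ 1]) (auto simp: det_single)
  finally show ?thesis unfolding bordered by simp
qed

text \<open>Given the upper equation, \<open>L b\<^sub>1 = C x\<^sub>1 + L B x\<^sub>2\<close>; subtracting this from the lower equation
  \<open>C x\<^sub>1 + D x\<^sub>2 = b\<^sub>2\<close> eliminates \<open>x\<^sub>1\<close>, and adding it back is the converse.\<close>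

lemma solution_four_block_iff_schur:
  fixes A0 :: "'a :: field mat"
  assumes A0: "A0 \<in> carrier_mat k k" and B: "B \<in> carrier_mat k m"
    and C: "C \<in> carrier_mat m k" and D: "D \<in> carrier_mat m m"
    and L: "L \<in> carrier_mat m k" and LA0: "L * A0 = C"
    and b1: "b1 \<in> carrier_vec k" and b2: "b2 \<in> carrier_vec m"
    and x1: "x1 \<in> carrier_vec k" and x2: "x2 \<in> carrier_vec m"
  shows "four_block_mat A0 B C D *\<^sub>v (x1 @\<^sub>v x2) = b1 @\<^sub>v b2 \<longleftrightarrow>
    A0 *\<^sub>v x1 + B *\<^sub>v x2 = b1 \<and> (D - L * B) *\<^sub>v x2 = b2 - L *\<^sub>v b1"
proof -
  have "four_block_mat A0 B C D *\<^sub>v (x1 @\<^sub>v x2) = b1 @\<^sub>v b2 \<longleftrightarrow>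
      A0 *\<^sub>v x1 + B *\<^sub>v x2 = b1 \<and> C *\<^sub>v x1 + D *\<^sub>v x2 = b2"
    using A0 B b1 x1 x2
    by (subst four_block_mat_mult_vec[OF A0 B C D x1 x2], subst append_vec_eq[of _ k]) auto
  moreover have "C *\<^sub>v x1 + D *\<^sub>v x2 = b2 \<longleftrightarrow> (D - L * B) *\<^sub>v x2 = b2 - L *\<^sub>v b1"
    if upper: "A0 *\<^sub>v x1 + B *\<^sub>v x2 = b1"
  proof -
    have "L *\<^sub>v b1 = L *\<^sub>v (A0 *\<^sub>v x1) + L *\<^sub>v (B *\<^sub>v x2)"
      unfolding upper[symmetric]
      using A0 B L x1 x2 by (intro mult_add_distrib_mat_vec) auto
    also have "L *\<^sub>v (A0 *\<^sub>v x1) = C *\<^sub>v x1"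
      using assoc_mult_mat_vec[OF L A0 x1] LA0 by simp
    finally have Lb1: "L *\<^sub>v b1 = C *\<^sub>v x1 + L *\<^sub>v (B *\<^sub>v x2)" .
    have S: "(D - L * B) *\<^sub>v x2 = D *\<^sub>v x2 - L *\<^sub>v (B *\<^sub>v x2)"
      using minus_mult_distrib_mat_vec[OF D _ x2, of "L * B"] assoc_mult_mat_vec[OF L B x2] L B
      by simp
    have ring: "p + q = b2 \<longleftrightarrow> q - r = b2 - (p + r)"
      if "p \<in> carrier_vec m" "q \<in> carrier_vec m" "r \<in> carrier_vec m" for p q r :: "'a vec"
      using that b2 by (auto simp: vec_eq_iff algebra_simps)
    show ?thesis
      unfolding Lb1 S using B C D L x1 x2 by (intro ring) auto
  qed
  ultimately show ?thesis by blast
qed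

text \<open>Invertibility of \<open>A\<^sub>0\<close> serves uniqueness: it lets any competing solution of the reduced system be
  extended by back substitution to a solution of the full system, which is unique.\<close>

lemma unique_solution_schur_complement:
  fixes A0 :: "'a :: field mat"
  assumes A0: "A0 \<in> carrier_mat k k" and inv: "invertible_mat A0" and B: "B \<in> carrier_mat k m"
    and C: "C \<in> carrier_mat m k" and D: "D \<in> carrier_mat m m"
    and L: "L \<in> carrier_mat m k" and LA0: "L * A0 = C"
    and b1: "b1 \<in> carrier_vec k" and b2: "b2 \<in> carrier_vec m"
    and x1: "x1 \<in> carrier_vec k" and x2: "x2 \<in> carrier_vec m"
    and uniq: "is_unique_solution (four_block_mat A0 B C D) (b1 @\<^sub>v b2) (x1 @\<^sub>v x2)"
  shows "is_unique_solution (D - L * B) (b2 - L *\<^sub>v b1) x2"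
proof -
  note iff = solution_four_block_iff_schur[OF A0 B C D L LA0 b1 b2]
  have sol: "is_solution (four_block_mat A0 B C D) (b1 @\<^sub>v b2) (y1 @\<^sub>v y2) \<longleftrightarrow>
      four_block_mat A0 B C D *\<^sub>v (y1 @\<^sub>v y2) = b1 @\<^sub>v b2"
    if "y1 \<in> carrier_vec k" "y2 \<in> carrier_vec m" for y1 y2
    using A0 D that unfolding is_solution_def by auto
  have "(D - L * B) *\<^sub>v x2 = b2 - L *\<^sub>v b1"
    using uniq x1 x2 unfolding is_unique_solution_def by (simp add: sol iff)
  moreover have "y2 = x2"
    if y2: "y2 \<in> carrier_vec m" and eq: "(D - L * B) *\<^sub>v y2 = b2 - L *\<^sub>v b1" for y2
  proof -
    obtain N where N: "N \<in> carrier_mat k k" "A0 * N = 1\<^sub>m k"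
      using invertible_mat_obtain_inverse[OF A0 inv] by blast
    \<comment> \<open>back substitution: the upper equation is solvable for every choice of the last unknowns\<close>
    define y1 where "y1 = N *\<^sub>v (b1 - B *\<^sub>v y2)"
    have y1: "y1 \<in> carrier_vec k"
      using N(1) b1 B y2 unfolding y1_def by (intro mult_mat_vec_carrier[OF N(1)]) auto
    have "A0 *\<^sub>v y1 = b1 - B *\<^sub>v y2"
      using assoc_mult_mat_vec[OF A0 N(1), of "b1 - B *\<^sub>v y2"] N(2) b1 B y2
      unfolding y1_def by auto
    then have "A0 *\<^sub>v y1 + B *\<^sub>v y2 = b1"
      using b1 B y2 by (auto simp: vec_eq_iff)
    then have "is_solution (four_block_mat A0 B C D) (b1 @\<^sub>v b2) (y1 @\<^sub>v y2)"
      using y1 y2 eq by (simp add: sol iff)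
    then have "y1 @\<^sub>v y2 = x1 @\<^sub>v x2"
      using uniq unfolding is_unique_solution_def by blast
    then show "y2 = x2"
      using append_vec_eq[OF y1 x1] by blast
  qed
  moreover have "dim_col (D - L * B) = m" using B L D by simp
  ultimately show ?thesis
    using x2 unfolding is_unique_solution_def is_solution_def by metis
qed

lemma leading_block_four_block:
  assumes "A0 \<in> carrier_mat k k" and "D \<in> carrier_mat m m"
  shows "leading_block k (four_block_mat A0 B C D) = A0"
  using assms unfolding leading_block_def by (intro eq_matI) auto

context
  fixes A0 B C D L :: "'a :: field mat" and k m :: nat
  assumes A0: "A0 \<in> carrier_mat k k" and B: "B \<in> carrier_mat k m"
    and C: "C \<in> carrier_mat m k" and D: "D \<in> carrier_mat m m"
    and L: "L \<in> carrier_mat m k" and LA0: "L * A0 = C"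
begin

lemma row_L_combination:
  assumes "p < m" "j < k"
  shows "row L p \<bullet> col A0 j = C $$ (p, j)"
  using assms A0 L unfolding LA0[symmetric] by simp

text \<open>Row \<open>p\<close> of \<open>L\<close> expresses row \<open>p\<close> of \<open>C\<close> through the rows of \<open>A\<^sub>0\<close>, so it provides the elimination
  coefficients for every determinant bordered by that row, whatever the bordering column.  Taking
  the columns of \<open>B\<close> and then \<open>b\<^sub>1\<close> as that column gives the reduced matrix and right-hand side.\<close>

lemma C_hat_four_block: "C_hat k (four_block_mat A0 B C D) = det A0 \<cdot>\<^sub>m (D - L * B)"
proof (rule eq_matI)
  fix p q
  assume "p < dim_row (det A0 \<cdot>\<^sub>m (D - L * B))" "q < dim_col (det A0 \<cdot>\<^sub>m (D - L * B))"
  then have p: "p < m" and q: "q < m" using L B by auto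
  have cols: "vec k (\<lambda>i. four_block_mat A0 B C D $$ (i, k + q)) = col B q"
    "vec k (\<lambda>j. four_block_mat A0 B C D $$ (k + p, j)) = row C p"
    "four_block_mat A0 B C D $$ (k + p, k + q) = D $$ (p, q)"
    using A0 B C D p q by (auto simp: vec_eq_iff)
  have "c_hat k (four_block_mat A0 B C D) (k + p) (k + q)
      = det A0 * (D $$ (p, q) - row L p \<bullet> col B q)"
    unfolding c_hat_def leading_block_four_block[OF A0 D] cols
    using A0 B C L p q row_L_combination by (intro det_bordered_mat[of _ k]) auto
  then show "C_hat k (four_block_mat A0 B C D) $$ (p, q) = (det A0 \<cdot>\<^sub>m (D - L * B)) $$ (p, q)"
    using A0 B C D L p q unfolding C_hat_def by auto
qed (use A0 B D L in \<open>auto simp: C_hat_def\<close>)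

lemma b_reduced_four_block:
  assumes b1: "b1 \<in> carrier_vec k" and b2: "b2 \<in> carrier_vec m"
  shows "b_reduced k (four_block_mat A0 B C D) (b1 @\<^sub>v b2) = det A0 \<cdot>\<^sub>v (b2 - L *\<^sub>v b1)"
proof (rule eq_vecI)
  fix p
  assume "p < dim_vec (det A0 \<cdot>\<^sub>v (b2 - L *\<^sub>v b1))"
  then have p: "p < m" using L by auto
  have parts: "vec_first (b1 @\<^sub>v b2) k = b1"
    "vec k (\<lambda>i. four_block_mat A0 B C D $$ (k + p, i)) = row C p"
    "(b1 @\<^sub>v b2) $ (k + p) = b2 $ p"
    using A0 C D b1 b2 p by (auto simp: vec_eq_iff vec_first_def)
  have "b_prime k (four_block_mat A0 B C D) (b1 @\<^sub>v b2) (k + p)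
      = det A0 * (b2 $ p - row L p \<bullet> b1)"
    unfolding b_prime_def leading_block_four_block[OF A0 D] parts
    using A0 C L b1 p row_L_combination by (intro det_bordered_mat[of _ k]) auto
  then show "b_reduced k (four_block_mat A0 B C D) (b1 @\<^sub>v b2) $ p
      = (det A0 \<cdot>\<^sub>v (b2 - L *\<^sub>v b1)) $ p"
    using A0 D L b2 p unfolding b_reduced_def by auto
qed (use A0 D L in \<open>auto simp: b_reduced_def\<close>)

end

theorem theorem2p3:
  fixes A :: "'a :: field mat" and b :: "'a vec" and n k :: nat
  assumes "n \<ge> 2" and "1 \<le> k" and "k \<le> n - 1"
    and "A \<in> carrier_mat n n" and "invertible_mat A"
    and "b \<in> carrier_vec n"
    and "invertible_mat (leading_block k A)"
  shows "(\<exists>x. is_unique_solution A b x) \<and>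
    (\<forall>x. is_unique_solution A b x \<longrightarrow>
      is_unique_solution (C_hat k A) (b_reduced k A b) (vec_last x (n - k)))"
proof (intro conjI allI impI)
  show "\<exists>x. is_unique_solution A b x"
    using assms by (intro invertible_mat_unique_solution)
next
  fix x
  assume uniq: "is_unique_solution A b x"
  define m where "m = n - k"
  have n: "n = k + m" using assms(1,3) unfolding m_def by simp
  obtain A0 B C D where split: "split_block A k k = (A0, B, C, D)"
    by (cases "split_block A k k") auto
  have A0: "A0 \<in> carrier_mat k k" and B: "B \<in> carrier_mat k m" and C: "C \<in> carrier_mat m k"
    and D: "D \<in> carrier_mat m m" and A: "A = four_block_mat A0 B C D"
    using split_block[OF split, of m m] assms(4) n by auto
  have inv: "invertible_mat A0"
    using assms(7) unfolding A leading_block_four_block[OF A0 D] .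
  obtain N where N: "N \<in> carrier_mat k k" "N * A0 = 1\<^sub>m k"
    using invertible_mat_obtain_inverse[OF A0 inv] by blast
  define L where "L = C * N"
  have L: "L \<in> carrier_mat m k" using C N unfolding L_def by auto
  have LA0: "L * A0 = C"
    using assoc_mult_mat[OF C N(1) A0] N(2) C unfolding L_def by simp
  have det: "det A0 \<noteq> 0" by (rule invertible_mat_det_nonzero[OF A0 inv])
  define b1 b2 where "b1 = vec_first b k" and "b2 = vec_last b m"
  define x1 x2 where "x1 = vec_first x k" and "x2 = vec_last x m"
  have x: "x \<in> carrier_vec n"
    using uniq assms(4) unfolding is_unique_solution_def is_solution_def by auto
  have parts: "b = b1 @\<^sub>v b2" "x = x1 @\<^sub>v x2" "b1 \<in> carrier_vec k" "b2 \<in> carrier_vec m"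
    "x1 \<in> carrier_vec k" "x2 \<in> carrier_vec m"
    using assms(6) x n unfolding b1_def b2_def x1_def x2_def by auto
  have block_uniq: "is_unique_solution (four_block_mat A0 B C D) (b1 @\<^sub>v b2) (x1 @\<^sub>v x2)"
    using uniq by (simp only: A[symmetric] parts(1,2)[symmetric])
  have "is_unique_solution (D - L * B) (b2 - L *\<^sub>v b1) x2"
    by (rule unique_solution_schur_complement[OF A0 inv B C D L LA0 parts(3-6) block_uniq])
  moreover have "D - L * B \<in> carrier_mat m m" "b2 - L *\<^sub>v b1 \<in> carrier_vec m"
    using L B D parts by auto
  ultimately have "is_unique_solution (det A0 \<cdot>\<^sub>m (D - L * B)) (det A0 \<cdot>\<^sub>v (b2 - L *\<^sub>v b1)) x2"
    using is_unique_solution_smult[OF _ _ det] by blast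
  then have "is_unique_solution (C_hat k A) (b_reduced k A b) x2"
    using C_hat_four_block[OF A0 B C D L LA0] b_reduced_four_block[OF A0 B C D L LA0 parts(3,4)]
    by (simp only: A[symmetric] parts(1)[symmetric])
  then show "is_unique_solution (C_hat k A) (b_reduced k A b) (vec_last x (n - k))"
    unfolding x2_def m_def .
qed

end
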